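(* For every $n\ge 1$, the map $\eta$ is injective on $\mathrm{Sort}_n(132)$, and the image of $\mathrm{Sort}_n(132)$ under $\eta$ is $\mathcal{RGF}_n(12231)$.
   Context: The map $\eta$: let $\pi=\pi_1\cdots\pi_n$ be a permutation with left-to-right minima $m_1>m_2>\dots>m_t$ (an entry is a left-to-right minimum if it is smaller than all entries preceding it), and set $m_0=+\infty$. Define $\eta(\pi)=r_1\cdots r_n$, where $r_i=j$ if $m_j\le\pi_i<m_{j-1}$. A restricted growth function of length $n$ is a word $r_1\cdots r_n$ of positive integers with $r_1=1$ and $r_{i+1}\le 1+\max\{r_1,\dots,r_i\}$ for each $i\le n-1$. A word $x$ contains a pattern $y=y_1\cdots y_k$ if it has a subsequence $x_{i_1}\cdots x_{i_k}$ ($i_1<\dots<i_k$) such that for all $s,t$: $x_{i_s}<x_{i_t}$ iff $y_s<y_t$, and $x_{i_s}=x_{i_t}$ iff $y_s=y_t$; otherwise $x$ avoids $y$. $\mathcal{RGF}_n(12231)$ is the set of restricted growth functions of length $n$ avoiding $12231$. For a permutation $\sigma$ of length at least $2$, the $\sigma$-stack acts on an input permutation $\pi=\pi_1\cdots\pi_n$ as follows (starting with empty stack and output). For $i=1,\dots,n$: as long as pushing $\pi_i$ on top of the stack would make the content of the stack, read from top to bottom, contain an occurrence of $\sigma$, pop the top element and append it to the output; then push $\pi_i$. After all letters have been pushed, pop all remaining elements, from top to bottom, appending them to the output. The resulting output is denoted $\mathcal{S}^{\sigma}(\pi)$. The permutation $\pi$ of length $n$ is $\sigma$-sortable if $\mathcal{S}^{21}(\mathcal{S}^{\sigma}(\pi))=12\cdots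 n$. $\mathrm{Sort}_n(\sigma)$ is the set of $\sigma$-sortable permutations of length $n$. *)

theory Defs
  imports
    "HOL-Library.Sublist"
    "HOL-Library.Extended_Nat"
    "HOL-Combinatorics.Multiset_Permutations"
begin

text \<open>
  Words are lists of natural numbers; permutations of length \<open>n\<close> are given in one-line notation,
  as the elements of \<open>permutations_of_set {1..n}\<close>. List positions start at 0.
\<close>

definition order_isomorphic :: "nat list \<Rightarrow> nat list \<Rightarrow> bool" where
  "order_isomorphic z y \<longleftrightarrow>
     length z = length y \<and>
     (\<forall>s<length y. \<forall>t<length y.
        (z ! s < z ! t \<longleftrightarrow> y ! s < y ! t) \<and> (z ! s = z ! t \<longleftrightarrow> y ! s = y ! t))"

definition contains_pattern :: "nat list \<Rightarrow> nat list \<Rightarrow> bool" where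
  "contains_pattern x y \<longleftrightarrow> (\<exists>z. subseq z x \<and> order_isomorphic z y)"

abbreviation avoids_pattern :: "nat list \<Rightarrow> nat list \<Rightarrow> bool" where
  "avoids_pattern x y \<equiv> \<not> contains_pattern x y"

text \<open>
  Stacks are lists whose head is the top. \<open>pop_before_push \<sigma> a st\<close> performs the pops that precede
  the push of \<open>a\<close>, and returns the popped letters in the order in which they are output, together
  with the remaining stack. If \<open>\<sigma>\<close> has length at least 2, then pushing onto the empty stack never
  creates an occurrence of \<open>\<sigma>\<close>, so no pop from the empty stack is ever required.
\<close>

fun pop_before_push :: "nat list \<Rightarrow> nat \<Rightarrow> nat list \<Rightarrow> nat list \<times> nat list" where
  "pop_before_push \<sigma> a [] = ([], [])"
| "pop_before_push \<sigma> a (s # st) =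
     (if contains_pattern (a # s # st) \<sigma>
      then (case pop_before_push \<sigma> a st of (out, st') \<Rightarrow> (s # out, st'))
      else ([], s # st))"

text \<open>\<open>stack_output \<sigma> st inp\<close> is what is output from stack content \<open>st\<close> and remaining input \<open>inp\<close>.\<close>

fun stack_output :: "nat list \<Rightarrow> nat list \<Rightarrow> nat list \<Rightarrow> nat list" where
  "stack_output \<sigma> st [] = st"
| "stack_output \<sigma> st (a # inp) =
     (case pop_before_push \<sigma> a st of (out, st') \<Rightarrow> out @ stack_output \<sigma> (a # st') inp)"

definition stack_map :: "nat list \<Rightarrow> nat list \<Rightarrow> nat list" where
  "stack_map \<sigma> \<pi> = stack_output \<sigma> [] \<pi>"

definition Sort :: "nat \<Rightarrow> nat list \<Rightarrow> nat list set" where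
  "Sort n \<sigma> =
     {\<pi> \<in> permutations_of_set {1..n}. stack_map [2, 1] (stack_map \<sigma> \<pi>) = [1..<Suc n]}"

definition ltr_minima :: "nat list \<Rightarrow> nat list" where
  "ltr_minima \<pi> = map (\<lambda>i. \<pi> ! i) (filter (\<lambda>i. \<forall>j<i. \<pi> ! i < \<pi> ! j) [0..<length \<pi>])"

text \<open>The \<open>j\<close>-th left-to-right minimum \<open>m\<^sub>j\<close> for \<open>1 \<le> j \<le> t\<close>, with the convention \<open>m\<^sub>0 = \<infinity>\<close>.\<close>

definition ltr_min :: "nat list \<Rightarrow> nat \<Rightarrow> enat" where
  "ltr_min \<pi> j = (if j = 0 then \<infinity> else enat (ltr_minima \<pi> ! (j - 1)))"

definition \<eta> :: "nat list \<Rightarrow> nat list" where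
  "\<eta> \<pi> = map (\<lambda>x. THE j. j \<in> {1..length (ltr_minima \<pi>)} \<and>
                  ltr_min \<pi> j \<le> enat x \<and> enat x < ltr_min \<pi> (j - 1)) \<pi>"

definition RGF :: "nat \<Rightarrow> nat list set" where
  "RGF n =
     {r. length r = n \<and> (\<forall>x\<in>set r. 0 < x) \<and> (0 < n \<longrightarrow> r ! 0 = 1) \<and>
         (\<forall>i. 0 < i \<and> i < n \<longrightarrow> r ! i \<le> 1 + Max (set (take i r)))}"

definition RGF_avoiding :: "nat \<Rightarrow> nat list \<Rightarrow> nat list set" where
  "RGF_avoiding n y = {r \<in> RGF n. avoids_pattern r y}"

end

theory Submission
  imports Defs "HOL-Library.Product_Lexorder"
begin

text \<open>
  Call the entries that are not left-to-right minima non-minima. In the 132-stack the minima,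
  increasing from top to bottom, are never popped before the input ends, while each new minimum
  expels all non-minima on the stack. So the output is a word \<open>X\<close> of the non-minima followed by the
  minima in increasing order. The latter begin with 1, so an ascent in \<open>X\<close> would be completed by 1 to
  an occurrence of 231, which the classical stack cannot sort; if \<open>X\<close> is decreasing, it can. Hence a
  permutation is sortable exactly if its non-minima are output in decreasing order. Following the
  machine as long as this holds turns it into a condition on pairs of positions,
  \<open>descent_condition\<close> (\<open>run_132\<close>, \<open>Sort_132_iff\<close>): a non-minimum with a smaller entry after it
  exceeds everything after that entry, and the first smaller entry after a non-minimum is either a
  minimum itself or separated from it in value by a minimum.

  The labels given by \<open>\<eta>\<close> number the horizontal strips between consecutive minima from top to bottom,
  and the minima occur at the records of the label word. Under the descent condition the labels decide
  every comparison of two entries (\<open>nth_less_iff_below_eta\<close>), which gives injectivity. A label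
  pattern 12231 contradicts the first half of the condition at the letter that repeats 2.
  Conversely, the comparisons read off from a restricted growth function form a linear order of the
  positions; the permutation with this order has the prescribed labels, and it satisfies the descent
  condition if the function avoids 12231 (\<open>eta_surj\<close>).
\<close>

section \<open>Occurrences of the patterns\<close>

text \<open>The rules below speak of patterns with the literal letter 1, which has to survive simplification.\<close>

declare One_nat_def [simp del]

lemma subseq_iff_indices:
  "subseq z x \<longleftrightarrow> (\<exists>is. sorted_wrt (<) is \<and> set is \<subseteq> {..<length x} \<and> z = map ((!) x) is)"
proof
  assume "subseq z x"
  then obtain N where "z = nths (map ((!) x) [0..<length x]) N"
    by (auto simp: subseq_conv_nths map_nth)
  then have "z = map ((!) x) (nths [0..<length x] N)" by (simp only: nths_map)
  moreover have "sorted_wrt (<) (nths [0..<length x] N)"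
    by (simp add: strict_sorted_iff sorted_nths)
  moreover have "set (nths [0..<length x] N) \<subseteq> {..<length x}"
    using set_nths_subset[of "[0..<length x]" N] by auto
  ultimately show "\<exists>is. sorted_wrt (<) is \<and> set is \<subseteq> {..<length x} \<and> z = map ((!) x) is"
    by blast
next
  assume "\<exists>is. sorted_wrt (<) is \<and> set is \<subseteq> {..<length x} \<and> z = map ((!) x) is"
  then obtain "is" where *: "sorted_wrt (<) is" "set is \<subseteq> {..<length x}" "z = map ((!) x) is" by blast
  then have "is = filter (\<lambda>i. i \<in> set is) [0..<length x]"
    by (intro sorted_distinct_set_unique) (auto simp: strict_sorted_iff sorted_filter[of id, simplified])
  then have "subseq is [0..<length x]"
    by (metis subseq_filter_left)
  then have "subseq (map ((!) x) is) (map ((!) x) [0..<length x])" by (rule subseq_map)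
  then show "subseq z x" by (simp add: * map_nth)
qed

lemma subseq_pair_Cons: "subseq [x, y] (a # w) \<longleftrightarrow> (x = a \<and> y \<in> set w) \<or> subseq [x, y] w"
  by (cases "x = a") (auto simp: subseq_singleton_left dest: subseq_Cons')

text \<open>The library rule would split on whether the first letters agree, which the pair rule avoids.\<close>

declare subseq_Cons2_iff [simp del]

lemma subseq_pair_append:
  "subseq [c, b] (D @ M) \<longleftrightarrow> subseq [c, b] D \<or> (c \<in> set D \<and> b \<in> set M) \<or> subseq [c, b] M"
  by (induction D) (auto simp: subseq_pair_Cons)

lemma subseq_pair_sorted_wrt: "subseq [c, b] w \<Longrightarrow> sorted_wrt R w \<Longrightarrow> R c b"
  by (induction w) (auto simp: subseq_pair_Cons)

lemma subseq_pair_set: "subseq [c, b] w \<Longrightarrow> c \<in> set w \<and> b \<in> set w"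
  by (induction w) (auto simp: subseq_pair_Cons)

lemma order_isomorphic_21: "order_isomorphic z [2, 1] \<longleftrightarrow> (\<exists>x y. z = [x, y] \<and> y < x)"
  unfolding order_isomorphic_def by (auto simp: length_Suc_conv numeral_eq_Suc All_less_Suc)

lemma order_isomorphic_132:
  "order_isomorphic z [1, 3, 2] \<longleftrightarrow> (\<exists>x y w. z = [x, y, w] \<and> x < w \<and> w < y)"
  unfolding order_isomorphic_def by (auto simp: length_Suc_conv numeral_eq_Suc All_less_Suc)

lemma order_isomorphic_12231:
  "order_isomorphic z [1, 2, 2, 3, 1] \<longleftrightarrow> (\<exists>x y w. z = [x, y, y, w, x] \<and> x < y \<and> y < w)"
  unfolding order_isomorphic_def by (auto simp: length_Suc_conv numeral_eq_Suc All_less_Suc)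

lemma contains_21_Cons:
  "contains_pattern (a # w) [2, 1] \<longleftrightarrow> (\<exists>y\<in>set w. y < a) \<or> contains_pattern w [2, 1]"
  unfolding contains_pattern_def order_isomorphic_21
  by (metis subseq_pair_Cons)

lemma contains_21_iff: "contains_pattern w [2, 1] \<longleftrightarrow> \<not> sorted w"
proof (induction w)
  case Nil
  show ?case by (auto simp: contains_pattern_def order_isomorphic_21)
next
  case (Cons a w)
  then show ?case by (auto simp: contains_21_Cons not_le)
qed

lemma contains_132_Cons:
  "contains_pattern (a # w) [1, 3, 2] \<longleftrightarrow>
     (\<exists>c b. subseq [c, b] w \<and> a < b \<and> b < c) \<or> contains_pattern w [1, 3, 2]"
proof -
  have "subseq [x, y, z] (a # w) \<longleftrightarrow> (x = a \<and> subseq [y, z] w) \<or> subseq [x, y, z] w" for x y z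
    by (cases "x = a") (auto dest: subseq_Cons')
  then show ?thesis
    unfolding contains_pattern_def order_isomorphic_132 by metis
qed

lemma contains_12231_iff:
  "contains_pattern r [1, 2, 2, 3, 1] \<longleftrightarrow>
     (\<exists>i1 i2 i3 i4 i5. i1 < i2 \<and> i2 < i3 \<and> i3 < i4 \<and> i4 < i5 \<and> i5 < length r \<and>
        r ! i1 < r ! i2 \<and> r ! i2 = r ! i3 \<and> r ! i3 < r ! i4 \<and> r ! i5 = r ! i1)" (is "?L \<longleftrightarrow> ?R")
proof
  assume ?L
  then obtain "is" a b c where ind: "sorted_wrt (<) is" "set is \<subseteq> {..<length r}"
      "map ((!) r) is = [a, b, b, c, a]" "a < b" "b < c"
    unfolding contains_pattern_def order_isomorphic_12231 subseq_iff_indices by metis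
  then obtain i1 i2 i3 i4 i5 where "is = [i1, i2, i3, i4, i5]"
    by (auto simp: map_eq_Cons_conv)
  with ind have "i1 < i2 \<and> i2 < i3 \<and> i3 < i4 \<and> i4 < i5 \<and> i5 < length r"
    and "r ! i1 = a \<and> r ! i2 = b \<and> r ! i3 = b \<and> r ! i4 = c \<and> r ! i5 = a"
    by simp_all
  with ind(4,5) show ?R by metis
next
  assume ?R
  then obtain i1 i2 i3 i4 i5 where i: "i1 < i2" "i2 < i3" "i3 < i4" "i4 < i5" "i5 < length r"
    "r ! i1 < r ! i2" "r ! i2 = r ! i3" "r ! i3 < r ! i4" "r ! i5 = r ! i1" by blast
  then have "subseq (map ((!) r) [i1, i2, i3, i4, i5]) r"
    unfolding subseq_iff_indices by (intro exI[of _ "[i1, i2, i3, i4, i5]"]) auto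
  with i show ?L
    unfolding contains_pattern_def order_isomorphic_12231 by force
qed

section \<open>Runs of a stack\<close>

definition step :: "nat list \<Rightarrow> nat list \<times> nat list \<Rightarrow> nat \<Rightarrow> nat list \<times> nat list" where
  "step \<sigma> s a = (case pop_before_push \<sigma> a (snd s) of (out, st) \<Rightarrow> (fst s @ out, a # st))"

text \<open>Inductions below append letters to the input, so the machine is also described by its state,
  the output produced so far together with the stack, after a prefix of the input.\<close>

definition run :: "nat list \<Rightarrow> nat list \<Rightarrow> nat list \<times> nat list" where
  "run \<sigma> u = foldl (step \<sigma>) ([], []) u"

lemma run_Nil [simp]: "run \<sigma> [] = ([], [])"
  by (simp add: run_def)

lemma run_snoc: "run \<sigma> (u @ [a]) = step \<sigma> (run \<sigma> u) a"
  by (simp add: run_def)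

lemma stack_map_run: "stack_map \<sigma> u = fst (run \<sigma> u) @ snd (run \<sigma> u)"
proof -
  have "fst (foldl (step \<sigma>) s u) @ snd (foldl (step \<sigma>) s u) = fst s @ stack_output \<sigma> (snd s) u" for s
    by (induction u arbitrary: s) (simp_all add: step_def split: prod.splits)
  from this[of "([], [])"] show ?thesis
    by (simp add: run_def stack_map_def)
qed

lemma pop_before_push_append:
  "pop_before_push \<sigma> a st = (out, st') \<Longrightarrow> out @ st' = st"
  by (induction st arbitrary: out) (auto split: if_splits prod.splits)

lemma mset_stack_output: "mset (stack_output \<sigma> st inp) = mset st + mset inp"
  by (induction inp arbitrary: st)
    (auto split: prod.splits dest!: pop_before_push_append)

lemma set_run: "set (fst (run \<sigma> u)) \<union> set (snd (run \<sigma> u)) = set u"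
proof -
  have "mset (fst (run \<sigma> u) @ snd (run \<sigma> u)) = mset u"
    using mset_stack_output[of \<sigma> "[]" u] by (simp only: stack_map_run[symmetric] stack_map_def) simp
  then show ?thesis by (metis mset_eq_setD set_append)
qed

text \<open>Output is never revised, so what a prefix of the input forces out stays in front.\<close>

lemma prefix_stack_map: "prefix (fst (run \<sigma> u)) (stack_map \<sigma> (u @ v))"
proof -
  have "prefix (fst (run \<sigma> u)) (fst (run \<sigma> (u @ v)))"
  proof (induction v rule: rev_induct)
    case (snoc a v)
    then show ?case
      using run_snoc[of \<sigma> "u @ v" a]
      by (auto simp: step_def split: prod.splits intro: prefix_order.trans)
  qed simp
  then show ?thesis by (simp add: stack_map_run prefix_prefix)
qed

section \<open>The classical stack\<close>

text \<open>A sorted stack, smallest letter on top, contains 21 after a push exactly if the new letter is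
  larger than the top, so precisely the smaller letters leave.\<close>

lemma pop_21:
  "sorted st \<Longrightarrow> pop_before_push [2, 1] a st = (takeWhile (\<lambda>s. s < a) st, dropWhile (\<lambda>s. s < a) st)"
proof (induction st)
  case (Cons s st)
  then show ?case by (force simp: contains_21_iff)
qed simp

lemma dropWhile_less_ge:
  fixes a :: nat
  assumes "sorted st" "x \<in> set (dropWhile (\<lambda>s. s < a) st)"
  shows "a \<le> x"
  using assms by (induction st) (auto split: if_splits)

lemma sorted_run_21: "sorted (snd (run [2, 1] u))"
proof (induction u rule: rev_induct)
  case (snoc a u)
  then show ?case
    by (auto simp: run_snoc step_def pop_21 intro: sorted_dropWhile dropWhile_less_ge)
qed simp

lemma stack_output_21_decreasing:
  assumes "sorted_wrt (>) X" "sorted st" "\<forall>x\<in>set X. \<forall>s\<in>set st. x < s"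
  shows "stack_output [2, 1] st (X @ M) = stack_output [2, 1] (rev X @ st) M"
  using assms
proof (induction X arbitrary: st)
  case (Cons x X)
  have "pop_before_push [2, 1] x st = ([], st)"
    using Cons.prems by (cases st) (auto simp: pop_21 simp del: pop_before_push.simps)
  moreover have "sorted (x # st)" using Cons.prems by (auto intro: less_imp_le)
  ultimately show ?case using Cons.prems by (auto intro!: Cons.IH)
qed simp

lemma sorted_stack_output_21:
  assumes "sorted st" "sorted inp"
  shows "sorted (stack_output [2, 1] st inp)"
  using assms
proof (induction inp arbitrary: st)
  case (Cons a inp)
  let ?t = "takeWhile (\<lambda>s. s < a) st" and ?d = "dropWhile (\<lambda>s. s < a) st"
  have d: "sorted ?d" using Cons.prems by (intro sorted_dropWhile)
  have "\<forall>x\<in>set ?d. a \<le> x" using Cons.prems dropWhile_less_ge by blast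
  moreover have "set (stack_output [2, 1] (a # ?d) inp) = set (a # ?d @ inp)"
    using mset_stack_output[of "[2, 1]" "a # ?d" inp]
    by (metis append_Cons mset_append set_mset_mset)
  moreover have "sorted ?t" using Cons.prems by (intro sorted_takeWhile)
  ultimately show ?case
    using Cons d by (fastforce simp: pop_21 sorted_append dest: set_takeWhileD)
qed simp

text \<open>With 1 arriving after all of \<open>X\<close>, no letter of \<open>X\<close> may be output before 1 is read. An ascent in
  \<open>X\<close> pops its smaller letter at once. If \<open>X\<close> is decreasing, it is stored entirely, and from there
  on the machine merges two increasing sequences.\<close>

lemma stack_map_21_eq_upt_iff:
  assumes perm: "X @ M \<in> permutations_of_set {1..n}"
    and M: "sorted_wrt (<) M" "M \<noteq> []" "hd M = 1"
  shows "stack_map [2, 1] (X @ M) = [1..<Suc n] \<longleftrightarrow> sorted_wrt (>) X"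
proof
  assume X: "sorted_wrt (>) X"
  have "sorted (stack_map [2, 1] (X @ M))"
  proof -
    have "stack_map [2, 1] (X @ M) = stack_output [2, 1] (rev X) M"
      unfolding stack_map_def using X by (subst stack_output_21_decreasing) auto
    moreover have "sorted (rev X)"
      using X by (auto simp: sorted_wrt_rev intro: sorted_wrt_mono_rel[OF _ X])
    ultimately show ?thesis
      using M by (auto intro!: sorted_stack_output_21 simp: strict_sorted_iff)
  qed
  moreover have "mset (stack_map [2, 1] (X @ M)) = mset [1..<Suc n]"
  proof -
    have "mset (X @ M) = mset [1..<Suc n]"
      using perm by (subst set_eq_iff_mset_eq_distinct[symmetric]) (auto simp: permutations_of_set_def)
    then show ?thesis by (simp add: stack_map_def mset_stack_output)
  qed
  ultimately show "stack_map [2, 1] (X @ M) = [1..<Suc n]"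
    by (metis properties_for_sort sorted_upt)
next
  assume out: "stack_map [2, 1] (X @ M) = [1..<Suc n]"
  have "sorted_wrt (>) X"
  proof (rule ccontr)
    assume "\<not> sorted_wrt (>) X"
    then obtain i where i: "Suc i < length X" "\<not> X ! i > X ! Suc i"
      by (auto simp: sorted_wrt_iff_nth_Suc_transp)
    \<comment> \<open>The letter after the ascent bottom pops it, so the output starts before 1 is read.\<close>
    let ?u = "take i X" and ?b = "X ! i" and ?c = "X ! Suc i"
    have X: "X = (?u @ [?b]) @ [?c] @ drop (Suc (Suc i)) X"
      using i by (metis Cons_nth_drop_Suc Suc_lessD append.assoc append_Cons append_Nil append_take_drop_id)
    have "distinct X" using perm by (auto simp: permutations_of_set_def)
    then have "?b < ?c" using i by (metis Suc_lessD linorder_neqE_nat n_not_Suc_n nth_eq_iff_index_eq)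
    then have ne: "fst (run [2, 1] ((?u @ [?b]) @ [?c])) \<noteq> []"
      using pop_21[OF sorted_run_21[of "?u @ [?b]"]]
      unfolding run_snoc by (auto simp: step_def split: prod.splits)
    have "prefix (fst (run [2, 1] ((?u @ [?b]) @ [?c]))) [1..<Suc n]"
      using prefix_stack_map[of "[2, 1]" "(?u @ [?b]) @ [?c]" "drop (Suc (Suc i)) X @ M"] X out
      by (metis append.assoc)
    then have "hd [1..<Suc n] \<in> set (fst (run [2, 1] ((?u @ [?b]) @ [?c])))"
      using ne by (metis hd_append2 hd_in_set prefix_def)
    moreover have "n \<ge> 1" using perm M(2) by (cases n) (auto simp: permutations_of_set_def)
    ultimately have "1 \<in> set X"
      using set_run[of "[2, 1]" "(?u @ [?b]) @ [?c]"] X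
      by (metis UnCI hd_upt less_Suc_eq_le set_append append.assoc)
    moreover have "1 \<in> set M" using M by (metis hd_in_set)
    ultimately show False using perm by (auto simp: permutations_of_set_def)
  qed
  then show "sorted_wrt (>) X" .
qed

section \<open>Left-to-right minima\<close>

definition ltr_min_at :: "nat list \<Rightarrow> nat \<Rightarrow> bool" where
  "ltr_min_at u p \<longleftrightarrow> (\<forall>j<p. u ! p < u ! j)"

lemma ltr_min_at_snoc:
  "p < length u \<Longrightarrow> ltr_min_at (u @ [a]) p \<longleftrightarrow> ltr_min_at u p"
  "ltr_min_at (u @ [a]) (length u) \<longleftrightarrow> (\<forall>x\<in>set u. a < x)"
  by (auto simp: ltr_min_at_def nth_append all_set_conv_all_nth)

lemma set_ltr_minima: "set (ltr_minima u) = {u ! j |j. j < length u \<and> ltr_min_at u j}"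
  unfolding ltr_minima_def ltr_min_at_def by auto

lemma set_ltr_minima_subset: "set (ltr_minima u) \<subseteq> set u"
  by (auto simp: set_ltr_minima)

lemma ltr_minima_snoc:
  "ltr_minima (u @ [a]) = ltr_minima u @ (if \<forall>x\<in>set u. a < x then [a] else [])"
proof -
  have "filter (\<lambda>i. \<forall>j<i. (u @ [a]) ! i < (u @ [a]) ! j) [0..<length u]
      = filter (\<lambda>i. \<forall>j<i. u ! i < u ! j) [0..<length u]"
    by (rule filter_cong) (auto simp: nth_append)
  then show ?thesis
    unfolding ltr_minima_def by (auto simp: nth_append all_set_conv_all_nth in_set_conv_nth)
qed

lemma sorted_ltr_minima: "sorted_wrt (>) (ltr_minima u)"
proof (induction u rule: rev_induct)
  case Nil
  show ?case by (simp add: ltr_minima_def)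
next
  case (snoc a u)
  then show ?case using set_ltr_minima_subset[of u] by (auto simp: ltr_minima_snoc sorted_wrt_append)
qed

lemma last_ltr_minima:
  assumes "u \<noteq> []"
  shows "ltr_minima u \<noteq> [] \<and> last (ltr_minima u) = Min (set u)"
  using assms
proof (induction u rule: rev_induct)
  case (snoc a u)
  show ?case
  proof (cases "u = []")
    case True
    then show ?thesis by (simp add: ltr_minima_def)
  next
    case False
    then have "Min (set (u @ [a])) = min a (Min (set u))" by simp
    moreover have "min a b = (if a < b then a else b)" for b by (simp add: min_def)
    ultimately have "Min (set (u @ [a])) = (if a < Min (set u) then a else Min (set u))"
      by (simp only:)
    moreover have "ltr_minima (u @ [a]) = ltr_minima u @ (if a < Min (set u) then [a] else [])"
      using False by (simp add: ltr_minima_snoc)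
    moreover have "ltr_minima u \<noteq> []" "last (ltr_minima u) = Min (set u)"
      using snoc.IH False by auto
    ultimately show ?thesis
      by (cases "a < Min (set u)") (metis append_is_Nil_conv append_Nil2 last_snoc not_Cons_self2)+
  qed
qed simp

lemma ex_ltr_min_at_le: "\<exists>i\<le>j. ltr_min_at \<pi> i \<and> \<pi> ! i \<le> \<pi> ! j"
proof (induction j rule: less_induct)
  case (less j)
  show ?case
  proof (cases "ltr_min_at \<pi> j")
    case False
    then obtain k where "k < j" "\<pi> ! k \<le> \<pi> ! j" by (auto simp: ltr_min_at_def not_less)
    with less[of k] show ?thesis by (meson le_trans less_imp_le)
  qed auto
qed

section \<open>The 132-stack\<close>

text \<open>A decreasing sequence followed by an increasing one avoids 132, so a new letter on top can only
  play the role of 1.\<close>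

lemma contains_132_Cons_decreasing_increasing:
  assumes "sorted_wrt (>) D" "sorted_wrt (<) M"
  shows "contains_pattern (a # D @ M) [1, 3, 2] \<longleftrightarrow> (\<exists>c b. subseq [c, b] (D @ M) \<and> a < b \<and> b < c)"
proof -
  have "\<not> contains_pattern M [1, 3, 2]"
    using assms(2)
  proof (induction M)
    case Nil
    show ?case by (auto simp: contains_pattern_def order_isomorphic_132)
  next
    case (Cons m M)
    then show ?case by (auto simp: contains_132_Cons dest: subseq_pair_sorted_wrt)
  qed
  then have "\<not> contains_pattern (D @ M) [1, 3, 2]"
    using assms(1)
  proof (induction D)
    case (Cons d D)
    then show ?case
      using assms(2)
      by (auto simp: contains_132_Cons subseq_pair_append dest: subseq_pair_sorted_wrt)
        (metis subseq_pair_set less_trans not_less_iff_gr_or_eq)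
  qed simp
  then show ?thesis by (simp add: contains_132_Cons)
qed

text \<open>Here \<open>D\<close> are the non-minima on the stack and \<open>M\<close> the left-to-right minima below them. A separating
  minimum \<open>m\<close> makes \<open>a d m\<close> an occurrence of 132. A new minimum \<open>a\<close> is separated from every \<open>d\<close> by
  the previous minimum.\<close>

lemma pop_132_separated:
  assumes "sorted_wrt (<) M" "\<forall>d\<in>set D. \<exists>m\<in>set M. a < m \<and> m < d"
  shows "pop_before_push [1, 3, 2] a (D @ M) = (D, M)"
  using assms(2)
proof (induction D)
  case Nil
  have "\<not> contains_pattern (a # M) [1, 3, 2]"
    using contains_132_Cons_decreasing_increasing[of "[]" M a] assms(1)
    by (auto dest: subseq_pair_sorted_wrt)
  then show ?case by (cases M) simp_all
next
  case (Cons d D)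
  then have "contains_pattern (a # d # D @ M) [1, 3, 2]"
    by (auto simp: contains_132_Cons subseq_pair_Cons)
  with Cons show ?case by simp
qed

text \<open>The minima alone, increasing from the top, never form 132 with the new letter; hence they stay on
  the stack until the input is exhausted.\<close>

lemma pop_132_keeps_minima:
  assumes "sorted_wrt (<) M"
  shows "\<exists>P D'. D = P @ D' \<and> pop_before_push [1, 3, 2] a (D @ M) = (P, D' @ M)"
proof (induction D)
  case Nil
  show ?case using pop_132_separated[OF assms, of "[]" a] by simp
next
  case (Cons d D)
  then obtain P D' where "D = P @ D'" "pop_before_push [1, 3, 2] a (D @ M) = (P, D' @ M)" by blast
  then show ?case
    by (cases "contains_pattern (a # d # D @ M) [1, 3, 2]") (auto intro: exI[of _ "d # P"])
qed

text \<open>As \<open>d\<close> is the largest letter of \<open>d # D\<close>, it may replace the letter that plays 3.\<close>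

lemma contains_132_Cons_Cons_decreasing_increasing:
  assumes "sorted_wrt (>) (d # D)" "sorted_wrt (<) M"
  shows "contains_pattern (a # d # D @ M) [1, 3, 2] \<longleftrightarrow> (\<exists>e\<in>set (D @ M). a < e \<and> e < d)"
proof
  assume "contains_pattern (a # d # D @ M) [1, 3, 2]"
  then obtain c b where cb: "subseq [c, b] ((d # D) @ M)" "a < b" "b < c"
    using contains_132_Cons_decreasing_increasing[OF assms, of a] by auto
  moreover have "\<not> subseq [c, b] M"
    using assms(2) cb by (auto dest: subseq_pair_sorted_wrt)
  ultimately have c: "c \<in> set (d # D)" and b: "b \<in> set (D @ M)"
    by (auto simp: subseq_pair_append subseq_pair_Cons dest: subseq_pair_set)
  then have "c \<le> d" using assms(1) by auto
  with b cb show "\<exists>e\<in>set (D @ M). a < e \<and> e < d" by auto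
next
  assume "\<exists>e\<in>set (D @ M). a < e \<and> e < d"
  then show "contains_pattern (a # d # D @ M) [1, 3, 2]"
    by (auto simp: contains_132_Cons subseq_pair_Cons)
qed

lemma pop_132_all_greater:
  assumes "sorted_wrt (>) D" "sorted_wrt (<) M" "\<forall>d\<in>set D. a < d \<longrightarrow> (\<exists>m\<in>set M. a < m \<and> m < d)"
  shows "pop_before_push [1, 3, 2] a (D @ M) = (filter (\<lambda>d. a < d) D, filter (\<lambda>d. d \<le> a) D @ M)"
  using assms(1,3)
proof (induction D)
  case Nil
  show ?case using pop_132_separated[OF assms(2), of "[]" a] by simp
next
  case (Cons d D)
  note c = contains_132_Cons_Cons_decreasing_increasing[OF Cons.prems(1) assms(2), of a]
  show ?case
  proof (cases "a < d")
    case True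
    then have "contains_pattern (a # d # D @ M) [1, 3, 2]" using c Cons.prems(2) by auto
    with Cons True show ?thesis by simp
  next
    case False
    then have "\<not> contains_pattern (a # d # D @ M) [1, 3, 2]" using c by auto
    moreover have "\<forall>x\<in>set D. x \<le> a" using Cons.prems(1) False by auto
    ultimately show ?thesis using False by (auto simp: filter_empty_conv filter_id_conv not_less)
  qed
qed

text \<open>Among the letters of \<open>D\<close> above \<open>a\<close> that no minimum separates from \<open>a\<close>, the smallest one cannot
  be popped: the letter that completes a 132 with \<open>a\<close> and it would be no minimum,
  hence a smaller such letter.\<close>

lemma pop_132_leaves_greater:
  assumes "sorted_wrt (>) D" "sorted_wrt (<) M"
    and "d \<in> set D" "a < d" "\<forall>m\<in>set M. \<not> (a < m \<and> m < d)"
    and "pop_before_push [1, 3, 2] a (D @ M) = (P, D' @ M)"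
  shows "\<exists>d'\<in>set D'. a < d'"
  using assms(1,3-)
proof (induction D arbitrary: P d)
  case (Cons s D)
  note c = contains_132_Cons_Cons_decreasing_increasing[OF Cons.prems(1) assms(2), of a]
  show ?case
  proof (cases "contains_pattern (a # s # D @ M) [1, 3, 2]")
    case True
    then obtain P' where P': "pop_before_push [1, 3, 2] a (D @ M) = (P', D' @ M)"
      using Cons.prems by (auto split: prod.splits)
    obtain e where e: "e \<in> set (D @ M)" "a < e" "e < s" using c True by blast
    show ?thesis
    proof (cases "d \<in> set D")
      case True
      with P' Cons show ?thesis by auto
    next
      case False
      with Cons.prems have "d = s" by simp
      have "e \<in> set D" using e Cons.prems(4) \<open>d = s\<close> by auto
      moreover have "\<forall>m\<in>set M. \<not> (a < m \<and> m < e)"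
        using e(3) Cons.prems(4) \<open>d = s\<close> less_trans by blast
      ultimately have e: "e \<in> set D" "\<forall>m\<in>set M. \<not> (a < m \<and> m < e)" "a < e"
        using e(2) by auto
      with P' e Cons show ?thesis by auto
    qed
  next
    case False
    then have "D' = s # D" using Cons.prems(5) by simp
    with Cons.prems show ?thesis by auto
  qed
qed simp

definition undercut :: "nat list \<Rightarrow> nat \<Rightarrow> bool" where
  "undercut u p \<longleftrightarrow> (\<exists>k<length u. p < k \<and> u ! k < u ! p)"

text \<open>What the arrival of position \<open>q\<close> requires of an earlier non-minimum at \<open>p\<close>. If an entry
  between them has undercut \<open>p\<close>, then \<open>p\<close> has left the stack and must be larger than everything that
  follows. Otherwise \<open>p\<close> is still on the stack, and if it is larger than a non-minimum at \<open>q\<close>, it has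
  to be popped, which needs a minimum between the two values.\<close>

definition descends :: "nat list \<Rightarrow> nat \<Rightarrow> nat \<Rightarrow> bool" where
  "descends u p q \<longleftrightarrow>
     (undercut (take q u) p \<longrightarrow> u ! q < u ! p) \<and>
     (\<not> undercut (take q u) p \<and> \<not> ltr_min_at u q \<and> u ! q < u ! p \<longrightarrow>
        (\<exists>j<q. ltr_min_at u j \<and> u ! q < u ! j \<and> u ! j < u ! p))"

definition descent_condition :: "nat list \<Rightarrow> bool" where
  "descent_condition u \<longleftrightarrow>
     (\<forall>q<length u. \<forall>p<q. \<not> ltr_min_at u p \<longrightarrow> descends u p q)"

lemma undercut_snoc:
  "p < length u \<Longrightarrow> undercut (u @ [a]) p \<longleftrightarrow> undercut u p \<or> a < u ! p"
  "\<not> undercut (u @ [a]) (length u)"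
  unfolding undercut_def length_append list.size add_0_right add_Suc_right Ex_less_Suc
  by (auto simp: nth_append)

lemma undercut_take: "undercut (take q u) p \<longleftrightarrow> (\<exists>k<q. p < k \<and> u ! k < u ! p)"
  if "p < q" "q < length u"
  using that by (auto simp: undercut_def)

lemma descent_condition_snoc:
  "descent_condition (u @ [a]) \<longleftrightarrow> descent_condition u \<and>
     (\<forall>p<length u. \<not> ltr_min_at u p \<longrightarrow>
        (undercut u p \<longrightarrow> a < u ! p) \<and>
        (\<not> undercut u p \<and> \<not> (\<forall>x\<in>set u. a < x) \<and> a < u ! p \<longrightarrow>
           (\<exists>m\<in>set (ltr_minima u). a < m \<and> m < u ! p)))"
proof -
  have *: "(\<exists>m\<in>set (ltr_minima u). a < m \<and> m < x) \<longleftrightarrow>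
     (\<exists>j<length u. ltr_min_at u j \<and> a < u ! j \<and> u ! j < x)" for x
    by (auto simp: set_ltr_minima)
  have "descends (u @ [a]) p q \<longleftrightarrow> descends u p q" if "p < q" "q < length u" for p q
    using that unfolding descends_def
    by (auto simp: ltr_min_at_snoc nth_append cong: conj_cong)
  then have "(\<forall>q<length u. \<forall>p<q. \<not> ltr_min_at (u @ [a]) p \<longrightarrow> descends (u @ [a]) p q) \<longleftrightarrow> descent_condition u"
    unfolding descent_condition_def by (auto simp: ltr_min_at_snoc)
  then show ?thesis
    unfolding descent_condition_def[of "u @ [a]"] length_append list.size add_0_right add_Suc_right All_less_Suc
    by (auto simp: descends_def * ltr_min_at_snoc nth_append cong: conj_cong)
qed

text \<open>Letters keep their relative order in \<open>out @ D\<close> up to the final output. As long as this word is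
  decreasing, each new non-minimum must expel exactly the larger letters of \<open>D\<close>; thus a letter has
  been output exactly if it was undercut, and the next step succeeds exactly if \<open>descends\<close> holds for
  the new position. Distinctness excludes ties between the new letter and those on the stack.\<close>

lemma run_132:
  assumes "distinct u"
  shows "\<exists>out D. run [1, 3, 2] u = (out, D @ rev (ltr_minima u)) \<and>
     (sorted_wrt (>) (out @ D) \<longleftrightarrow> descent_condition u) \<and>
     (\<forall>d\<in>set D. Min (set u) < d) \<and>
     (descent_condition u \<longrightarrow>
        set out = {x. \<exists>p<length u. u ! p = x \<and> \<not> ltr_min_at u p \<and> undercut u p} \<and>
        set D = {x. \<exists>p<length u. u ! p = x \<and> \<not> ltr_min_at u p \<and> \<not> undercut u p})"
  using assms
proof (induction u rule: rev_induct)
  case Nil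
  show ?case by (simp add: descent_condition_def ltr_minima_def)
next
  case (snoc a u)
  let ?M = "rev (ltr_minima u)"
  let ?O = "\<lambda>u. {x. \<exists>p<length u. u ! p = x \<and> \<not> ltr_min_at u p \<and> undercut u p}"
  let ?D = "\<lambda>u. {x. \<exists>p<length u. u ! p = x \<and> \<not> ltr_min_at u p \<and> \<not> undercut u p}"
  from snoc obtain out D where run: "run [1, 3, 2] u = (out, D @ ?M)"
    and good: "sorted_wrt (>) (out @ D) \<longleftrightarrow> descent_condition u"
    and gt: "\<forall>d\<in>set D. Min (set u) < d"
    and sets: "descent_condition u \<Longrightarrow> set out = ?O u" "descent_condition u \<Longrightarrow> set D = ?D u"
    by auto
  have M: "sorted_wrt (<) ?M" using sorted_ltr_minima[of u] by (simp add: sorted_wrt_rev)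
  have Min: "u \<noteq> [] \<Longrightarrow> Min (set u) \<in> set ?M"
    using last_ltr_minima[of u] last_in_set[of "ltr_minima u"] by simp
  have ex: "(\<exists>p<length (u @ [a]). (u @ [a]) ! p = x \<and> Q p) \<longleftrightarrow>
      (\<exists>p<length u. u ! p = x \<and> Q p) \<or> (x = a \<and> Q (length u))" for x Q
    unfolding length_append list.size add_0_right add_Suc_right Ex_less_Suc
    by (auto simp: nth_append)
  have snocO: "?O (u @ [a]) = ?O u \<union> {x \<in> ?D u. a < x}"
    unfolding ex by (rule set_eqI) (simp add: ltr_min_at_snoc undercut_snoc cong: conj_cong; blast)
  have snocD: "?D (u @ [a]) = {x \<in> ?D u. \<not> a < x} \<union> (if \<forall>x\<in>set u. a < x then {} else {a})"
    unfolding ex by (rule set_eqI) (simp add: ltr_min_at_snoc undercut_snoc cong: conj_cong; blast)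
  show ?case
  proof (cases "\<forall>x\<in>set u. a < x")
    case True
    \<comment> \<open>A new minimum empties \<open>D\<close> onto the output without changing the order in \<open>out @ D\<close>.\<close>
    have "D = [] \<or> u \<noteq> []"
      using set_run[of "[1, 3, 2]" u] run by auto
    then have "\<forall>d\<in>set D. \<exists>m\<in>set ?M. a < m \<and> m < d"
      using gt Min True by (metis Min_in emptyE list.set(1) set_empty List.finite_set)
    from pop_132_separated[OF M this]
    have "run [1, 3, 2] (u @ [a]) = (out @ D, [] @ rev (ltr_minima (u @ [a])))"
      using True by (simp add: run_snoc step_def run ltr_minima_snoc)
    moreover have "descent_condition (u @ [a]) \<longleftrightarrow> descent_condition u"
      using True by (auto simp: descent_condition_snoc)
    moreover have "?O (u @ [a]) = ?O u \<union> ?D u" "?D (u @ [a]) = {}"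
      unfolding snocO snocD using True by auto
    ultimately show ?thesis using good sets by (intro exI[of _ "out @ D"] exI[of _ "[]"]) simp
  next
    case False
    then obtain x where "x \<in> set u" "x \<le> a" by (auto simp: not_less)
    then have "u \<noteq> []" by auto
    moreover have "Min (set u) \<le> a"
      using Min_le[OF List.finite_set \<open>x \<in> set u\<close>] \<open>x \<le> a\<close> by (rule order.trans)
    moreover have "Min (set u) \<noteq> a"
      using snoc.prems calculation(1) Min_in[of "set u"] by auto
    ultimately have "u \<noteq> []" "Min (set u) < a" by simp_all
    obtain P D' where P: "D = P @ D'" "pop_before_push [1, 3, 2] a (D @ ?M) = (P, D' @ ?M)"
      using pop_132_keeps_minima[OF M] by blast
    have run': "run [1, 3, 2] (u @ [a]) = (out @ P, (a # D') @ rev (ltr_minima (u @ [a])))"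
      using False P by (simp add: run_snoc step_def run ltr_minima_snoc)
    have gt': "\<forall>d\<in>set (a # D'). Min (set (u @ [a])) < d"
      using P gt \<open>Min (set u) < a\<close> \<open>u \<noteq> []\<close> by (auto simp: min_def simp del: Min_less_iff Min_le_iff Min_gr_iff Min_ge_iff)
    show ?thesis
    proof (cases "descent_condition u")
      case False
      \<comment> \<open>An ascent in \<open>out @ D\<close> survives, since these letters keep their relative order.\<close>
      then have "\<not> descent_condition (u @ [a])" by (simp add: descent_condition_snoc)
      moreover have "\<not> sorted_wrt (>) ((out @ P) @ (a # D'))"
        using good False P by (auto simp: sorted_wrt_append)
      ultimately show ?thesis using run' gt' by blast
    next
      case True
      note sets = sets[OF True]
      have sorted: "sorted_wrt (>) (out @ D)" using good True by simp
      have next_iff: "descent_condition (u @ [a]) \<longleftrightarrow>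
          (\<forall>x\<in>set out. a < x) \<and> (\<forall>x\<in>set D. a < x \<longrightarrow> (\<exists>m\<in>set ?M. a < m \<and> m < x))"
        unfolding descent_condition_snoc sets using True \<open>\<not> (\<forall>x\<in>set u. a < x)\<close> by auto
      have imp: "P = filter (\<lambda>d. a < d) D \<and> D' = filter (\<lambda>d. d \<le> a) D" if "descent_condition (u @ [a])"
        using pop_132_all_greater[of D ?M a] P sorted M that next_iff by (auto simp: sorted_wrt_append)
      have "a \<notin> set D" using set_run[of "[1, 3, 2]" u] run snoc.prems by auto
      have "sorted_wrt (>) ((out @ P) @ (a # D')) \<longleftrightarrow> descent_condition (u @ [a])"
      proof
        assume s: "sorted_wrt (>) ((out @ P) @ (a # D'))"
        then have "\<forall>d\<in>set D'. \<not> a < d" by (auto simp: sorted_wrt_append)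
        then have "\<forall>x\<in>set D. a < x \<longrightarrow> (\<exists>m\<in>set ?M. a < m \<and> m < x)"
          using pop_132_leaves_greater[of D ?M _ a P D'] sorted M P(2)
          unfolding sorted_wrt_append by metis
        with s show "descent_condition (u @ [a])" unfolding next_iff by (auto simp: sorted_wrt_append)
      next
        assume d: "descent_condition (u @ [a])"
        have "\<forall>x\<in>set P. a < x" "\<forall>x\<in>set D'. x < a"
          using imp[OF d] \<open>a \<notin> set D\<close> by (auto simp: le_less)
        with d sorted next_iff P(1) show "sorted_wrt (>) ((out @ P) @ (a # D'))"
          by (auto simp: sorted_wrt_append)
      qed
      moreover have "set (out @ P) = ?O (u @ [a]) \<and> set (a # D') = ?D (u @ [a])"
        if "descent_condition (u @ [a])"
        unfolding snocO snocD using imp[OF that] sets \<open>\<not> (\<forall>x\<in>set u. a < x)\<close> by auto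
      ultimately show ?thesis using run' gt' by blast
    qed
  qed
qed

text \<open>The output of the 132-stack is a word \<open>X\<close> of all non-minima followed by the minima in increasing
  order, beginning with 1; the second stack sorts it exactly if \<open>X\<close> is decreasing.\<close>

lemma Sort_132_iff:
  assumes "n \<ge> 1"
  shows "\<pi> \<in> Sort n [1, 3, 2] \<longleftrightarrow> \<pi> \<in> permutations_of_set {1..n} \<and> descent_condition \<pi>"
proof (cases "\<pi> \<in> permutations_of_set {1..n}")
  case True
  then have \<pi>: "set \<pi> = {1..n}" "distinct \<pi>" by (auto simp: permutations_of_set_def)
  then have "\<pi> \<noteq> []" using assms by auto
  from run_132[OF \<pi>(2)] obtain out D where
    run: "run [1, 3, 2] \<pi> = (out, D @ rev (ltr_minima \<pi>))"
    and good: "sorted_wrt (>) (out @ D) \<longleftrightarrow> descent_condition \<pi>" by blast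
  have out: "stack_map [1, 3, 2] \<pi> = (out @ D) @ rev (ltr_minima \<pi>)"
    by (simp add: stack_map_run run)
  have "mset (stack_map [1, 3, 2] \<pi>) = mset \<pi>"
    by (simp add: stack_map_def mset_stack_output)
  then have "stack_map [1, 3, 2] \<pi> \<in> permutations_of_set {1..n}"
    using \<pi> by (metis mset_eq_setD mset_eq_imp_distinct_iff permutations_of_setI)
  moreover have "Min {1..n} = 1" using assms by (intro Min_eqI) auto
  then have "ltr_minima \<pi> \<noteq> []" "hd (rev (ltr_minima \<pi>)) = 1"
    using last_ltr_minima[OF \<open>\<pi> \<noteq> []\<close>] \<pi> by (auto simp: hd_rev)
  ultimately show ?thesis
    using True good stack_map_21_eq_upt_iff[of "out @ D" "rev (ltr_minima \<pi>)" n] sorted_ltr_minima[of \<pi>]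
    by (simp add: Sort_def out sorted_wrt_rev)
qed (simp add: Sort_def)

section \<open>Labels by strips\<close>

text \<open>The terms of a decreasing sequence that exceed \<open>x\<close> form an initial segment of it.\<close>

lemma nth_decreasing_greater_iff:
  fixes ms :: "nat list"
  assumes "sorted_wrt (>) ms" "i < length ms"
  shows "x < ms ! i \<longleftrightarrow> i < card {m \<in> set ms. x < m}"
  using assms
proof (induction ms arbitrary: i)
  case (Cons m ms)
  show ?case
  proof (cases "x < m")
    case True
    then have "{m' \<in> set (m # ms). x < m'} = insert m {m' \<in> set ms. x < m'}" by auto
    moreover have "m \<notin> set ms" using Cons.prems by auto
    ultimately have "card {m' \<in> set (m # ms). x < m'} = Suc (card {m' \<in> set ms. x < m'})" by simp
    with Cons True show ?thesis by (cases i) auto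
  next
    case False
    then have *: "{m' \<in> set (m # ms). x < m'} = {}" using Cons.prems by auto
    have "(m # ms) ! i \<le> m" using Cons.prems by (cases i) (auto intro: less_imp_le)
    with False show ?thesis unfolding * by simp
  qed
qed simp

text \<open>The left-to-right minima cut the values into horizontal strips, numbered from the top.\<close>

definition strip :: "nat list \<Rightarrow> nat \<Rightarrow> nat" where
  "strip \<pi> x = Suc (card {m \<in> set (ltr_minima \<pi>). x < m})"

text \<open>The index \<open>j\<close> with \<open>m\<^sub>j \<le> x < m\<^bsub>j-1\<^esub>\<close> is one more than the number of minima above \<open>x\<close>; such an
  index exists because the last minimum is the smallest entry.\<close>

lemma eta_eq_map_strip: "\<eta> \<pi> = map (strip \<pi>) \<pi>"
proof -
  have "(THE j. j \<in> {1..length (ltr_minima \<pi>)} \<and> ltr_min \<pi> j \<le> enat x \<and> enat x < ltr_min \<pi> (j - 1))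
        = strip \<pi> x" if x: "x \<in> set \<pi>" for x
  proof (rule the_equality)
    let ?ms = "ltr_minima \<pi>"
    define k where "k = card {m \<in> set ?ms. x < m}"
    note nth = nth_decreasing_greater_iff[OF sorted_ltr_minima[of \<pi>], of _ x, folded k_def]
    have "\<pi> \<noteq> []" using x by auto
    then have last: "last ?ms \<le> x" and ne: "?ms \<noteq> []" using last_ltr_minima[of \<pi>] x by simp_all
    with last have "k < length ?ms"
      using nth[of "length ?ms - 1"] by (cases "length ?ms"; auto simp: last_conv_nth not_less)
    then show "strip \<pi> x \<in> {1..length ?ms} \<and> ltr_min \<pi> (strip \<pi> x) \<le> enat x
        \<and> enat x < ltr_min \<pi> (strip \<pi> x - 1)"
      using nth[of k] nth[of "k - 1"] unfolding strip_def k_def[symmetric]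
      by (cases k) (auto simp: ltr_min_def not_less Suc_le_eq)
    fix j assume j: "j \<in> {1..length ?ms} \<and> ltr_min \<pi> j \<le> enat x \<and> enat x < ltr_min \<pi> (j - 1)"
    then have "k \<le> j - 1" "j - 1 \<noteq> 0 \<longrightarrow> j - 2 < k"
      using ne nth[of "j - 1"] nth[of "j - 2"]
      by (auto simp: ltr_min_def numeral_2_eq_2 not_less diff_less split: if_splits)
    then show "j = strip \<pi> x" using j unfolding strip_def k_def[symmetric] by auto
  qed
  then show ?thesis unfolding \<eta>_def by auto
qed

lemma strip_less_iff: "strip \<pi> x < strip \<pi> y \<longleftrightarrow> (\<exists>m\<in>set (ltr_minima \<pi>). y < m \<and> m \<le> x)"
proof
  assume "strip \<pi> x < strip \<pi> y"
  then have "\<not> {m \<in> set (ltr_minima \<pi>). y < m} \<subseteq> {m \<in> set (ltr_minima \<pi>). x < m}"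
    using card_mono[of "{m \<in> set (ltr_minima \<pi>). x < m}" "{m \<in> set (ltr_minima \<pi>). y < m}"]
    unfolding strip_def by (auto simp del: subset_iff)
  then show "\<exists>m\<in>set (ltr_minima \<pi>). y < m \<and> m \<le> x" by (auto simp: not_less)
next
  assume "\<exists>m\<in>set (ltr_minima \<pi>). y < m \<and> m \<le> x"
  then obtain m where m: "m \<in> set (ltr_minima \<pi>)" "y < m" "m \<le> x" by blast
  then have "{m \<in> set (ltr_minima \<pi>). x < m} \<subseteq> {m \<in> set (ltr_minima \<pi>). y < m}"
    by auto
  moreover have "m \<in> {m \<in> set (ltr_minima \<pi>). y < m}" "m \<notin> {m \<in> set (ltr_minima \<pi>). x < m}"
    using m by simp_all
  ultimately have "{m \<in> set (ltr_minima \<pi>). x < m} \<subset> {m \<in> set (ltr_minima \<pi>). y < m}"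
    by blast
  then show "strip \<pi> x < strip \<pi> y"
    unfolding strip_def by (simp add: psubset_card_mono)
qed

lemma length_eta [simp]: "length (\<eta> \<pi>) = length \<pi>"
  by (simp add: eta_eq_map_strip)

lemma nth_eta: "p < length \<pi> \<Longrightarrow> \<eta> \<pi> ! p = strip \<pi> (\<pi> ! p)"
  by (simp add: eta_eq_map_strip)

lemma ltr_min_at_in_ltr_minima: "j < length \<pi> \<Longrightarrow> ltr_min_at \<pi> j \<Longrightarrow> \<pi> ! j \<in> set (ltr_minima \<pi>)"
  by (auto simp: set_ltr_minima)

lemma eta_less_imp: "\<eta> \<pi> ! p < \<eta> \<pi> ! q \<Longrightarrow> p < length \<pi> \<Longrightarrow> q < length \<pi> \<Longrightarrow> \<pi> ! q < \<pi> ! p"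
  by (auto simp: nth_eta strip_less_iff)

lemma eta_less_via_minimum:
  "j < length \<pi> \<Longrightarrow> ltr_min_at \<pi> j \<Longrightarrow> \<pi> ! q < \<pi> ! j \<Longrightarrow> \<pi> ! j \<le> \<pi> ! p \<Longrightarrow>
   p < length \<pi> \<Longrightarrow> q < length \<pi> \<Longrightarrow> \<eta> \<pi> ! p < \<eta> \<pi> ! q"
  using ltr_min_at_in_ltr_minima by (auto simp: nth_eta strip_less_iff)

definition is_record :: "nat list \<Rightarrow> nat \<Rightarrow> bool" where
  "is_record r p \<longleftrightarrow> (\<forall>j<p. r ! j < r ! p)"

text \<open>A left-to-right minimum opens a new lowest strip, and any other entry lies in the strip of an
  earlier entry or above. So the word of labels shows where the minima are.\<close>

lemma record_eta_iff: "is_record (\<eta> \<pi>) p \<longleftrightarrow> ltr_min_at \<pi> p" if "p < length \<pi>"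
proof
  assume *: "is_record (\<eta> \<pi>) p"
  show "ltr_min_at \<pi> p"
    unfolding ltr_min_at_def
  proof (intro allI impI)
    fix j assume "j < p"
    then show "\<pi> ! p < \<pi> ! j"
      using * that eta_less_imp[of \<pi> j p] by (auto simp: is_record_def)
  qed
next
  assume *: "ltr_min_at \<pi> p"
  show "is_record (\<eta> \<pi>) p"
    unfolding is_record_def
  proof (intro allI impI)
    fix j assume "j < p"
    obtain i where "i \<le> j" "ltr_min_at \<pi> i" "\<pi> ! i \<le> \<pi> ! j" using ex_ltr_min_at_le by blast
    then show "\<eta> \<pi> ! j < \<eta> \<pi> ! p"
      using * that \<open>j < p\<close> by (intro eta_less_via_minimum[of i]) (auto simp: ltr_min_at_def)
  qed
qed

text \<open>A new minimum opens the next strip, and all other entries lie in strips already met.\<close>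

lemma eta_in_RGF:
  assumes "length \<pi> = n"
  shows "\<eta> \<pi> \<in> RGF n"
proof -
  have "\<eta> \<pi> ! 0 = 1" if "0 < n"
  proof -
    have "\<not> \<pi> ! 0 < m" if m: "m \<in> set (ltr_minima \<pi>)" for m
    proof -
      obtain j where "m = \<pi> ! j" "ltr_min_at \<pi> j" using m by (auto simp: set_ltr_minima)
      then show ?thesis by (cases "j = 0") (auto simp: ltr_min_at_def not_less less_imp_le)
    qed
    then have "{m \<in> set (ltr_minima \<pi>). \<pi> ! 0 < m} = {}" by blast
    with that assms show ?thesis by (simp only: nth_eta strip_def card.empty One_nat_def)
  qed
  moreover have "\<eta> \<pi> ! i \<le> 1 + Max (set (take i (\<eta> \<pi>)))" if i: "0 < i" "i < n" for i
  proof -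
    \<comment> \<open>Position \<open>k\<close> carries the smallest earlier entry; only that entry can be a minimum above
      \<open>\<pi> ! i\<close> without being above \<open>\<pi> ! k\<close>.\<close>
    obtain k where k: "k < i" "\<And>j. j < i \<Longrightarrow> \<pi> ! k \<le> \<pi> ! j"
      using ex_min_if_finite[of "(!) \<pi> ` {..<i}"] i by (auto simp: not_less)
    have "\<eta> \<pi> ! i \<le> 1 + \<eta> \<pi> ! k"
    proof -
      let ?S = "\<lambda>x. {m \<in> set (ltr_minima \<pi>). x < m}"
      have "?S (\<pi> ! i) \<subseteq> insert (\<pi> ! k) (?S (\<pi> ! k))"
      proof
        fix m assume "m \<in> ?S (\<pi> ! i)"
        then obtain j where j: "m = \<pi> ! j" "ltr_min_at \<pi> j" "\<pi> ! i < \<pi> ! j" "m \<in> set (ltr_minima \<pi>)"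
          by (auto simp: set_ltr_minima)
        then have "j < i" by (cases i j rule: linorder_cases) (auto simp: ltr_min_at_def)
        then have "\<pi> ! k \<le> m" using k(2) j(1) by simp
        with j(4) show "m \<in> insert (\<pi> ! k) (?S (\<pi> ! k))" by auto
      qed
      then have "card (?S (\<pi> ! i)) \<le> card (insert (\<pi> ! k) (?S (\<pi> ! k)))" by (intro card_mono) auto
      also have "\<dots> \<le> Suc (card (?S (\<pi> ! k)))" by (simp add: card_insert_if)
      finally show ?thesis using i k assms by (simp add: nth_eta strip_def)
    qed
    moreover have "\<eta> \<pi> ! k \<in> set (take i (\<eta> \<pi>))"
      using k i assms by (auto simp: in_set_conv_nth intro!: exI[of _ k])
    then have "\<eta> \<pi> ! k \<le> Max (set (take i (\<eta> \<pi>)))" by simp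
    ultimately show ?thesis by simp
  qed
  ultimately show ?thesis
    using assms by (auto simp: RGF_def eta_eq_map_strip[of \<pi>] strip_def)
qed

section \<open>Labels of sortable permutations\<close>

text \<open>The comparison of positions \<open>p < q\<close> that the labels dictate in a sortable permutation: a larger
  label means a smaller value; within a strip the record, being the minimum, is lowest, and two other
  positions ascend unless a lower strip is visited between them.\<close>

definition below :: "nat list \<Rightarrow> nat \<Rightarrow> nat \<Rightarrow> bool" where
  "below r p q \<longleftrightarrow> r ! q < r ! p \<or>
     (r ! p = r ! q \<and> (is_record r p \<or> \<not> (\<exists>k. p < k \<and> k < q \<and> r ! p < r ! k)))"

text \<open>Only two non-minima of equal label need an argument. A larger label between them undercuts the
  earlier one, which must then be the larger. If there is none, a descent would have to be crossed by
  a minimum, and then the labels would differ.\<close>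

lemma nth_less_iff_below_eta:
  assumes \<pi>: "descent_condition \<pi>" "distinct \<pi>" and pq: "p < q" "q < length \<pi>"
  shows "\<pi> ! p < \<pi> ! q \<longleftrightarrow> below (\<eta> \<pi>) p q"
proof -
  let ?r = "\<eta> \<pi>"
  have ne: "\<pi> ! p \<noteq> \<pi> ! q" using assms by (simp add: nth_eq_iff_index_eq)
  have descends: "descends \<pi> p j" if "p < j" "j < length \<pi>" "\<not> ltr_min_at \<pi> p" for j
    using that \<pi>(1) by (auto simp: descent_condition_def)
  consider (less) "?r ! q < ?r ! p" | (greater) "?r ! p < ?r ! q"
    | (min) "?r ! p = ?r ! q" "ltr_min_at \<pi> p" | (nonmin) "?r ! p = ?r ! q" "\<not> ltr_min_at \<pi> p"
    by linarith
  then show ?thesis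
  proof cases
    case less
    then show ?thesis using eta_less_imp[of \<pi> q p] pq by (simp add: below_def)
  next
    case greater
    then show ?thesis using eta_less_imp[of \<pi> p q] pq by (simp add: below_def)
  next
    case min
    then have "\<not> \<pi> ! q < \<pi> ! p" using eta_less_via_minimum[of p \<pi> q p] pq by auto
    with min ne show ?thesis using pq by (simp add: below_def record_eta_iff)
  next
    case nonmin
    have "\<not> is_record ?r q" using nonmin pq by (auto simp: is_record_def)
    then have "\<not> ltr_min_at \<pi> q" using record_eta_iff pq by blast
    have "\<pi> ! p < \<pi> ! q \<longleftrightarrow> \<not> (\<exists>k. p < k \<and> k < q \<and> ?r ! p < ?r ! k)"
    proof
      assume "\<pi> ! p < \<pi> ! q"
      then have "\<not> undercut (take q \<pi>) p" using descends[OF pq nonmin(2)] by (auto simp: descends_def)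
      then show "\<not> (\<exists>k. p < k \<and> k < q \<and> ?r ! p < ?r ! k)"
        using eta_less_imp[of \<pi> p] pq by (auto simp: undercut_take)
    next
      assume no: "\<not> (\<exists>k. p < k \<and> k < q \<and> ?r ! p < ?r ! k)"
      show "\<pi> ! p < \<pi> ! q"
      proof (rule ccontr)
        assume "\<not> \<pi> ! p < \<pi> ! q"
        then have "\<exists>k. p < k \<and> k \<le> q \<and> \<pi> ! k < \<pi> ! p" using ne pq by auto
        \<comment> \<open>For the first entry below \<open>\<pi> ! p\<close>, position \<open>p\<close> is not yet undercut, so a minimum separates.\<close>
        then obtain k where k: "p < k" "k \<le> q" "\<pi> ! k < \<pi> ! p"
          and least: "\<And>j. j < k \<Longrightarrow> \<not> (p < j \<and> j \<le> q \<and> \<pi> ! j < \<pi> ! p)"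
          using exists_least_iff[of "\<lambda>k. p < k \<and> k \<le> q \<and> \<pi> ! k < \<pi> ! p"] by blast
        have len: "p < length \<pi>" "k < length \<pi>" using k pq by auto
        have "?r ! k \<le> ?r ! p" using no nonmin(1) k by (metis le_neq_implies_less not_le order.refl)
        then have "\<not> is_record ?r k" using k by (auto simp: is_record_def not_less)
        then have "\<not> ltr_min_at \<pi> k" using record_eta_iff len by blast
        moreover have "\<not> undercut (take k \<pi>) p" using least k len by (auto simp: undercut_take)
        ultimately obtain j where "j < k" "ltr_min_at \<pi> j" "\<pi> ! k < \<pi> ! j" "\<pi> ! j < \<pi> ! p"
          using descends[OF k(1) len(2) nonmin(2)] k by (auto simp: descends_def)
        then have "?r ! p < ?r ! k" using len by (intro eta_less_via_minimum[of j]) auto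
        with \<open>?r ! k \<le> ?r ! p\<close> show False by simp
      qed
    qed
    then show ?thesis using nonmin pq by (simp add: below_def record_eta_iff)
  qed
qed

lemma nth_permutation_eq_card:
  assumes "\<pi> \<in> permutations_of_set {1..n}" "p < n"
  shows "\<pi> ! p = card {q. q < n \<and> \<pi> ! q \<le> \<pi> ! p}"
proof -
  have \<pi>: "set \<pi> = {1..n}" "distinct \<pi>" "length \<pi> = n"
    using assms by (auto simp: permutations_of_set_def distinct_card[symmetric])
  have "(!) \<pi> ` {q. q < n \<and> \<pi> ! q \<le> \<pi> ! p} = {1..\<pi> ! p}"
  proof
    show "(!) \<pi> ` {q. q < n \<and> \<pi> ! q \<le> \<pi> ! p} \<subseteq> {1..\<pi> ! p}"
      using \<pi> nth_mem[of _ \<pi>] by auto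
    show "{1..\<pi> ! p} \<subseteq> (!) \<pi> ` {q. q < n \<and> \<pi> ! q \<le> \<pi> ! p}"
    proof
      fix x assume x: "x \<in> {1..\<pi> ! p}"
      then have "x \<in> set \<pi>" using \<pi> assms(2) nth_mem[of p \<pi>] by auto
      then obtain q where "q < n" "\<pi> ! q = x" using \<pi>(3) by (auto simp: in_set_conv_nth)
      with x show "x \<in> (!) \<pi> ` {q. q < n \<and> \<pi> ! q \<le> \<pi> ! p}" by auto
    qed
  qed
  moreover have "inj_on ((!) \<pi>) {q. q < n \<and> \<pi> ! q \<le> \<pi> ! p}"
    using \<pi> by (auto simp: inj_on_def nth_eq_iff_index_eq)
  ultimately have "card {1..\<pi> ! p} = card {q. q < n \<and> \<pi> ! q \<le> \<pi> ! p}"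
    using card_image by metis
  then show ?thesis by simp
qed

text \<open>The labels determine all comparisons of entries, and these determine a permutation.\<close>

lemma inj_on_eta:
  assumes "\<And>\<pi>. \<pi> \<in> A \<Longrightarrow> \<pi> \<in> permutations_of_set {1..n} \<and> descent_condition \<pi>"
  shows "inj_on \<eta> A"
proof (rule inj_onI)
  fix \<pi> \<tau> assume "\<pi> \<in> A" "\<tau> \<in> A" and eq: "\<eta> \<pi> = \<eta> \<tau>"
  with assms have perm: "\<pi> \<in> permutations_of_set {1..n}" "\<tau> \<in> permutations_of_set {1..n}"
    and cond: "descent_condition \<pi>" "descent_condition \<tau>" by auto
  then have \<pi>: "distinct \<pi>" "length \<pi> = n" and \<tau>: "distinct \<tau>" "length \<tau> = n"
    by (auto simp: permutations_of_set_def distinct_card[symmetric])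
  have order_iff: "\<pi> ! p < \<pi> ! q \<longleftrightarrow> \<tau> ! p < \<tau> ! q" if "p < q" "q < n" for p q
    using nth_less_iff_below_eta cond \<pi> \<tau> that eq by metis
  have le: "\<pi> ! q \<le> \<pi> ! p \<longleftrightarrow> \<tau> ! q \<le> \<tau> ! p" if "p < n" "q < n" for p q
  proof (cases q p rule: linorder_cases)
    case less
    then show ?thesis using order_iff[of q p] that \<pi> \<tau> nth_eq_iff_index_eq[of \<pi> q p] nth_eq_iff_index_eq[of \<tau> q p]
      by (auto simp: le_less)
  next
    case greater
    then show ?thesis using order_iff[of p q] that by (auto simp: not_less[symmetric])
  qed simp
  show "\<pi> = \<tau>"
  proof (rule nth_equalityI)
    fix p assume "p < length \<pi>"
    then have "p < n" using \<pi> by simp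
    with le have "{q. q < n \<and> \<pi> ! q \<le> \<pi> ! p} = {q. q < n \<and> \<tau> ! q \<le> \<tau> ! p}" by auto
    with \<open>p < n\<close> show "\<pi> ! p = \<tau> ! p" using nth_permutation_eq_card perm by metis
  qed (simp add: \<pi> \<tau>)
qed

text \<open>In an occurrence at positions \<open>i1, i2, p, k, q\<close>, position \<open>p\<close> repeats a label and hence is no
  minimum; it is undercut by \<open>k\<close>, yet \<open>q\<close> lies in a higher strip.\<close>

lemma eta_avoids_12231:
  assumes "descent_condition \<pi>"
  shows "avoids_pattern (\<eta> \<pi>) [1, 2, 2, 3, 1]"
proof
  assume "contains_pattern (\<eta> \<pi>) [1, 2, 2, 3, 1]"
  then obtain i1 i2 p k q where i: "i1 < i2" "i2 < p" "p < k" "k < q" "q < length \<pi>"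
    and r: "\<eta> \<pi> ! i1 < \<eta> \<pi> ! i2" "\<eta> \<pi> ! i2 = \<eta> \<pi> ! p" "\<eta> \<pi> ! p < \<eta> \<pi> ! k" "\<eta> \<pi> ! q = \<eta> \<pi> ! i1"
    unfolding contains_12231_iff by auto
  have "\<not> is_record (\<eta> \<pi>) p" using i r by (auto simp: is_record_def)
  then have "\<not> ltr_min_at \<pi> p" using record_eta_iff[of p \<pi>] i by auto
  then have "descends \<pi> p q" using assms i by (auto simp: descent_condition_def)
  moreover have "undercut (take q \<pi>) p"
    using eta_less_imp[of \<pi> p k] i r by (auto simp: undercut_take)
  ultimately have "\<pi> ! q < \<pi> ! p" by (simp add: descends_def)
  moreover have "\<pi> ! p < \<pi> ! q" using eta_less_imp[of \<pi> q p] i r by auto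
  ultimately show False by simp
qed

section \<open>Sortable permutations with given labels\<close>

lemma RGF_ex_record:
  assumes "r \<in> RGF n" "p < n" "1 \<le> v" "v \<le> r ! p"
  shows "\<exists>i\<le>p. is_record r i \<and> r ! i = v"
proof -
  \<comment> \<open>The first entry that is at least \<open>v\<close> cannot skip \<open>v\<close>, by restricted growth.\<close>
  obtain i where i: "v \<le> r ! i" and least: "\<And>j. j < i \<Longrightarrow> r ! j < v"
    using exists_least_iff[of "\<lambda>i. v \<le> r ! i"] assms(4) by (auto simp: not_le)
  have "i \<le> p" using least[of p] assms(4) by (auto simp: not_less[symmetric])
  have "r ! i \<le> v"
  proof (cases "i = 0")
    case True
    then show ?thesis using assms by (auto simp: RGF_def)
  next
    case False
    have len: "length r = n" using assms by (simp add: RGF_def)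
    then have "take i r \<noteq> []" using False assms(2) by auto
    then have "Max (set (take i r)) \<in> set (take i r)" by (intro Max_in) auto
    then have "Max (set (take i r)) < v"
      using least by (metis in_set_conv_nth length_take min_less_iff_conj nth_take)
    moreover have "r ! i \<le> 1 + Max (set (take i r))"
      using assms False \<open>i \<le> p\<close> by (auto simp: RGF_def)
    ultimately show ?thesis by simp
  qed
  with i have "r ! i = v" by simp
  with least \<open>i \<le> p\<close> show ?thesis by (auto simp: is_record_def)
qed

text \<open>Replace every key by its rank.\<close>

lemma ex_permutation_with_order:
  fixes key :: "nat \<Rightarrow> 'a :: linorder"
  assumes "inj_on key {..<n}"
  shows "\<exists>\<pi>\<in>permutations_of_set {1..n}. \<forall>p<n. \<forall>q<n. \<pi> ! p < \<pi> ! q \<longleftrightarrow> key p < key q"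
proof -
  define rank where "rank = (\<lambda>p. card {k. k < n \<and> key k \<le> key p})"
  define \<pi> where "\<pi> = map rank [0..<n]"
  have mono: "rank p < rank q" if "p < n" "q < n" "key p < key q" for p q
    unfolding rank_def
  proof (rule psubset_card_mono)
    have "q \<in> {k. k < n \<and> key k \<le> key q}" "q \<notin> {k. k < n \<and> key k \<le> key p}"
      using that by auto
    moreover have "{k. k < n \<and> key k \<le> key p} \<subseteq> {k. k < n \<and> key k \<le> key q}"
      using that by auto
    ultimately show "{k. k < n \<and> key k \<le> key p} \<subset> {k. k < n \<and> key k \<le> key q}" by blast
  qed simp
  have less_iff: "rank p < rank q \<longleftrightarrow> key p < key q" if "p < n" "q < n" for p q
    using mono[OF that] mono[OF that(2,1)] that assms
    by (metis inj_onD lessThan_iff less_asym neqE)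
  have "inj_on rank {..<n}"
  proof (rule inj_onI)
    fix p q assume pq: "p \<in> {..<n}" "q \<in> {..<n}" and "rank p = rank q"
    then have "key p = key q" using less_iff[of p q] less_iff[of q p] by simp
    with pq assms show "p = q" by (simp add: inj_on_eq_iff)
  qed
  then have "distinct \<pi>" by (simp add: \<pi>_def distinct_map lessThan_atLeast0)
  moreover have "set \<pi> = {1..n}"
  proof (rule card_subset_eq)
    show "set \<pi> \<subseteq> {1..n}"
    proof
      fix x assume "x \<in> set \<pi>"
      then obtain p where p: "p < n" "x = rank p" by (auto simp: \<pi>_def)
      have "rank p \<le> card {..<n}" unfolding rank_def by (intro card_mono) auto
      moreover have "rank p > 0" unfolding rank_def using p by (auto simp: card_gt_0_iff)
      ultimately show "x \<in> {1..n}" using p by auto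
    qed
    show "card (set \<pi>) = card {1..n}" using \<open>distinct \<pi>\<close> by (simp add: distinct_card) (simp add: \<pi>_def)
  qed simp
  ultimately show ?thesis
    using less_iff by (intro bexI[of _ \<pi>]) (auto simp: \<pi>_def permutations_of_set_def)
qed

lemma ex_permutation_below:
  "\<exists>\<pi>\<in>permutations_of_set {1..n}. \<forall>q<n. \<forall>p<q. \<pi> ! p < \<pi> ! q \<longleftrightarrow> below r p q"
proof -
  define c where "c = (\<lambda>p. card {k. k < p \<and> r ! p < r ! k})"
  \<comment> \<open>Sorting by this key realises \<open>below\<close>: higher strips carry smaller labels; the record comes first
    in its strip, because \<open>False < True\<close>; the larger labels met so far cut the rest of a strip
    into runs, later runs lying lower; and a run is increasing.\<close>
  define key where "key = (\<lambda>p. (- int (r ! p), \<not> is_record r p, - int (c p), p))"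
  have "inj_on key {..<n}" by (auto simp: key_def inj_on_def)
  moreover have "key p < key q \<longleftrightarrow> below r p q" if "p < q" for p q
  proof (cases "r ! p = r ! q")
    case True
    then have nrec: "\<not> is_record r q" using that by (auto simp: is_record_def)
    have sub: "{k. k < p \<and> r ! p < r ! k} \<subseteq> {k. k < q \<and> r ! q < r ! k}" using that True by auto
    have "c p < c q \<longleftrightarrow> (\<exists>k. p < k \<and> k < q \<and> r ! p < r ! k)"
    proof
      assume "c p < c q"
      have "\<not> {k. k < q \<and> r ! q < r ! k} \<subseteq> {k. k < p \<and> r ! p < r ! k}"
      proof
        assume "{k. k < q \<and> r ! q < r ! k} \<subseteq> {k. k < p \<and> r ! p < r ! k}"
        then have "c q \<le> c p" unfolding c_def by (intro card_mono) simp_all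
        with \<open>c p < c q\<close> show False by simp
      qed
      then obtain k where "k < q" "r ! q < r ! k" "\<not> k < p" using True by auto
      then show "\<exists>k. p < k \<and> k < q \<and> r ! p < r ! k"
        using True by (metis linorder_neqE_nat less_irrefl)
    next
      assume "\<exists>k. p < k \<and> k < q \<and> r ! p < r ! k"
      then obtain k where "p < k" "k < q" "r ! p < r ! k" by blast
      then have "k \<in> {k. k < q \<and> r ! q < r ! k}" "k \<notin> {k. k < p \<and> r ! p < r ! k}"
        using True by simp_all
      with sub have "{k. k < p \<and> r ! p < r ! k} \<subset> {k. k < q \<and> r ! q < r ! k}" by blast
      then show "c p < c q" unfolding c_def by (intro psubset_card_mono) simp_all
    qed
    moreover have "c p \<le> c q" unfolding c_def using sub by (intro card_mono) auto
    ultimately show ?thesis using True nrec that by (auto simp: key_def below_def)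
  qed (auto simp: key_def below_def)
  ultimately show ?thesis
    using ex_permutation_with_order[of key n] by (metis less_trans)
qed

text \<open>The permutation whose comparisons are \<open>below r\<close> has its minima at the records of \<open>r\<close>, so its
  labels are those of \<open>r\<close>. For the descent condition, let \<open>p\<close> be a non-record. If \<open>q\<close> is lower and
  \<open>p\<close> has not been undercut, then the label has grown, and the record with the label of \<open>p\<close> lies
  between the two in value. If \<open>p\<close> has been undercut, then a larger label occurs at some \<open>k\<close> before
  \<open>q\<close>; were \<open>q\<close> higher than \<open>p\<close>, its label would be smaller, and \<open>p\<close>, \<open>k\<close>, \<open>q\<close> together with the
  records of the labels of \<open>q\<close> and \<open>p\<close> would form an occurrence of 12231.\<close>

lemma eta_surj:
  assumes r: "r \<in> RGF_avoiding n [1, 2, 2, 3, 1]"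
  shows "\<exists>\<pi>\<in>permutations_of_set {1..n}. descent_condition \<pi> \<and> \<eta> \<pi> = r"
proof -
  obtain \<pi> where perm: "\<pi> \<in> permutations_of_set {1..n}"
    and below: "\<And>p q. p < q \<Longrightarrow> q < n \<Longrightarrow> \<pi> ! p < \<pi> ! q \<longleftrightarrow> below r p q"
    using ex_permutation_below[of n r] by blast
  have rgf: "r \<in> RGF n" and avoid: "avoids_pattern r [1, 2, 2, 3, 1]"
    using r by (auto simp: RGF_avoiding_def)
  then have len_r: "length r = n" and pos: "\<And>p. p < n \<Longrightarrow> 1 \<le> r ! p"
    by (auto simp: RGF_def Suc_le_eq One_nat_def)
  have dist: "distinct \<pi>" and len: "length \<pi> = n"
    using perm by (auto simp: permutations_of_set_def distinct_card[symmetric])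
  have ne: "\<pi> ! p \<noteq> \<pi> ! q" if "p < n" "q < n" "p \<noteq> q" for p q
    using that dist len by (simp add: nth_eq_iff_index_eq)
  have larger: "\<pi> ! q < \<pi> ! p" if "r ! p < r ! q" "p < n" "q < n" for p q
  proof (cases p q rule: linorder_cases)
    case less
    with below[of p q] ne[of p q] that show ?thesis by (auto simp: below_def)
  next
    case greater
    with below[of q p] that show ?thesis by (auto simp: below_def)
  qed (use that in auto)
  have first: "\<pi> ! i < \<pi> ! p" if "is_record r i" "r ! i = r ! p" "i \<noteq> p" "i < n" "p < n" for i p
  proof -
    have "i < p" using that by (cases i p rule: linorder_cases) (auto simp: is_record_def)
    with below[of i p] that show ?thesis by (auto simp: below_def)
  qed
  have ex_first: "\<exists>i<p. is_record r i \<and> r ! i = r ! p" if "p < n" "\<not> is_record r p" for p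
    using RGF_ex_record[OF rgf that(1) pos[OF that(1)] order.refl] that(2)
    by (metis le_neq_implies_less)
  have min_iff: "ltr_min_at \<pi> p \<longleftrightarrow> is_record r p" if "p < n" for p
  proof
    assume *: "ltr_min_at \<pi> p"
    show "is_record r p"
    proof (rule ccontr)
      assume "\<not> is_record r p"
      then obtain i where "i < p" "is_record r i" "r ! i = r ! p" using ex_first \<open>p < n\<close> by blast
      then have "\<pi> ! i < \<pi> ! p" using first[of i p] that by auto
      with * \<open>i < p\<close> show False by (auto simp: ltr_min_at_def dest: less_asym)
    qed
  next
    assume "is_record r p"
    then show "ltr_min_at \<pi> p"
      using larger that by (auto simp: ltr_min_at_def is_record_def)
  qed
  have "\<eta> \<pi> = r"
  proof (rule nth_equalityI)
    fix p assume "p < length (\<eta> \<pi>)"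
    then have p: "p < n" by (simp add: len)
    let ?J = "{j. j < n \<and> is_record r j \<and> r ! j < r ! p}"
    \<comment> \<open>The minima above \<open>\<pi> ! p\<close> sit at the records of smaller label, one for each such label.\<close>
    have "{m \<in> set (ltr_minima \<pi>). \<pi> ! p < m} = (!) \<pi> ` ?J"
    proof -
      have "\<pi> ! p < \<pi> ! j \<longleftrightarrow> r ! j < r ! p" if "j < n" "is_record r j" for j
        using larger[of j p] larger[of p j] first[of j p] that p
        by (metis less_asym less_irrefl linorder_neqE_nat)
      then show ?thesis
        unfolding set_ltr_minima len using min_iff by auto
    qed
    moreover have "inj_on ((!) \<pi>) ?J" using ne by (auto simp: inj_on_def)
    ultimately have "strip \<pi> (\<pi> ! p) = Suc (card ?J)" by (simp add: strip_def card_image)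
    also have "card ?J = card {1..<r ! p}"
    proof (rule bij_betw_same_card[of "(!) r"])
      have "inj_on ((!) r) ?J"
        by (auto simp: inj_on_def is_record_def) (metis less_irrefl linorder_neqE_nat)
      moreover have "(!) r ` ?J = {1..<r ! p}"
      proof
        show "(!) r ` ?J \<subseteq> {1..<r ! p}" using pos by auto
        show "{1..<r ! p} \<subseteq> (!) r ` ?J"
        proof
          fix v assume v: "v \<in> {1..<r ! p}"
          then obtain i where "i \<le> p" "is_record r i" "r ! i = v"
            using RGF_ex_record[OF rgf p, of v] by auto
          with v p show "v \<in> (!) r ` ?J" by (auto intro!: image_eqI[of _ _ i])
        qed
      qed
      ultimately show "bij_betw ((!) r) ?J {1..<r ! p}" by (simp add: bij_betw_def)
    qed
    finally show "\<eta> \<pi> ! p = r ! p" using p len pos[OF p] by (simp add: nth_eta)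
  qed (simp add: len len_r)
  moreover have "descent_condition \<pi>"
    unfolding descent_condition_def len
  proof (intro allI impI)
    fix q p assume q: "q < n" and pq: "p < q" and "\<not> ltr_min_at \<pi> p"
    then have p: "p < n" and nrec: "\<not> is_record r p" using min_iff[of p] by auto
    obtain i where i: "i < p" "is_record r i" "r ! i = r ! p" using ex_first[OF p nrec] by blast
    have undercut_iff: "undercut (take q \<pi>) p \<longleftrightarrow> (\<exists>k. p < k \<and> k < q \<and> r ! p < r ! k)"
    proof
      assume "undercut (take q \<pi>) p"
      then obtain k where k: "k < q" "p < k" "\<pi> ! k < \<pi> ! p" using pq q len by (auto simp: undercut_take)
      then have "\<not> below r p k" using below[of p k] q by auto
      with nrec have "r ! p < r ! k \<or> (\<exists>k'. p < k' \<and> k' < k \<and> r ! p < r ! k')"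
        by (auto simp: below_def)
      with k show "\<exists>k. p < k \<and> k < q \<and> r ! p < r ! k" by (meson less_trans)
    next
      assume "\<exists>k. p < k \<and> k < q \<and> r ! p < r ! k"
      then show "undercut (take q \<pi>) p" using larger[of p] pq q len by (auto simp: undercut_take)
    qed
    show "descends \<pi> p q"
      unfolding descends_def
    proof (intro conjI impI)
      assume "undercut (take q \<pi>) p"
      then obtain k where k: "p < k" "k < q" "r ! p < r ! k" using undercut_iff by blast
      show "\<pi> ! q < \<pi> ! p"
      proof (rule ccontr)
        assume "\<not> \<pi> ! q < \<pi> ! p"
        \<comment> \<open>The records of the labels of \<open>q\<close> and \<open>p\<close>, then \<open>p\<close>, \<open>k\<close>, \<open>q\<close>, would form 12231.\<close>
        then have "below r p q" using below[OF pq q] ne[OF p q] pq by auto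
        then have "r ! q < r ! p" using k nrec by (auto simp: below_def)
        then obtain h where h: "h \<le> i" "r ! h = r ! q"
          using RGF_ex_record[OF rgf, of i "r ! q"] pos[OF q] i p by auto
        with \<open>r ! q < r ! p\<close> i have "h < i" by (metis le_neq_implies_less less_irrefl)
        then have "contains_pattern r [1, 2, 2, 3, 1]"
          unfolding contains_12231_iff using h i k q len_r \<open>r ! q < r ! p\<close> by metis
        with avoid show False by simp
      qed
    next
      assume *: "\<not> undercut (take q \<pi>) p \<and> \<not> ltr_min_at \<pi> q \<and> \<pi> ! q < \<pi> ! p"
      then have "\<not> below r p q" using below[OF pq q] by auto
      with * undercut_iff have "r ! p < r ! q" by (auto simp: below_def)
      then have "\<pi> ! q < \<pi> ! i" using larger[of i q] i p q by auto
      moreover have "\<pi> ! i < \<pi> ! p" using first[of i p] i p by auto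
      moreover have "ltr_min_at \<pi> i" using min_iff[of i] i p by auto
      ultimately show "\<exists>j<q. ltr_min_at \<pi> j \<and> \<pi> ! q < \<pi> ! j \<and> \<pi> ! j < \<pi> ! p"
        using i pq by (auto intro!: exI[of _ i])
    qed
  qed
  ultimately show ?thesis using perm by blast
qed

section \<open>Sortable permutations and restricted growth functions\<close>

theorem theorem5p13:
  fixes n :: nat
  assumes "n \<ge> 1"
  shows "inj_on \<eta> (Sort n [1, 3, 2]) \<and>
         \<eta> ` Sort n [1, 3, 2] = RGF_avoiding n [1, 2, 2, 3, 1]"
proof
  note Sort_iff = Sort_132_iff[OF assms]
  show "inj_on \<eta> (Sort n [1, 3, 2])"
    by (rule inj_on_eta[of _ n]) (simp add: Sort_iff)
  show "\<eta> ` Sort n [1, 3, 2] = RGF_avoiding n [1, 2, 2, 3, 1]"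
  proof
    show "\<eta> ` Sort n [1, 3, 2] \<subseteq> RGF_avoiding n [1, 2, 2, 3, 1]"
    proof
      fix r assume "r \<in> \<eta> ` Sort n [1, 3, 2]"
      then obtain \<pi> where "\<pi> \<in> permutations_of_set {1..n}" "descent_condition \<pi>" "r = \<eta> \<pi>"
        by (auto simp: Sort_iff)
      moreover from this have "length \<pi> = n"
        by (auto simp: permutations_of_set_def distinct_card[symmetric])
      ultimately show "r \<in> RGF_avoiding n [1, 2, 2, 3, 1]"
        by (simp add: RGF_avoiding_def eta_in_RGF eta_avoids_12231)
    qed
    show "RGF_avoiding n [1, 2, 2, 3, 1] \<subseteq> \<eta> ` Sort n [1, 3, 2]"
      using eta_surj Sort_iff by blast
  qed
qed

end
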